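(* Let $X$ and $Y$ be metric spaces and let $E$ and $F$ be nontrivial normed spaces. Suppose that $A(X,E)=C(X,E)$ or $C_*(X,E)$ and $A(Y,F)=C(Y,F)$ or $C_*(Y,F)$. Let $T:A(X,E)\to A(Y,F)$ be a biseparating map, represented by a homeomorphism $\varphi:X\to Y$ and functions $\Phi:Y\times E\to F$, $\Psi:X\times F\to E$ as $$(Tf)(y)=\Phi(y,f(\varphi^{-1}(y))),\qquad (T^{-1}g)(x)=\Psi(x,g(\varphi(x)))$$ for all $f\in A(X,E)$, $g\in A(Y,F)$, $x\in X$, $y\in Y$. For any compact subset $K$ of $Y'$, any $f\in A(X,E)$, and any $\varepsilon>0$, there exists $\delta>0$ such that $$g\in A(X,E),\ \|g-f\|_{\varphi^{-1}(K)}<\delta\implies\|Tg-Tf\|_K<\varepsilon.$$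
   Context: $C(X,E)$ is the space of continuous functions $X\to E$ and $C_*(X,E)$ its subspace of bounded functions. $Y'$ is the set of accumulation points of $Y$. For a compact set $K$ and a continuous normed-space-valued function $f$, $\|f\|_K=\sup\{\|f(x)\|: x\in K\}$. For a function $f$ let $C(f)=\{x: f(x)\neq 0\}$, and for functions $f,g,h$ in the same space write $f\perp_h g$ if $C(f-h)\cap C(g-h)=\emptyset$. A map $T$ (not assumed linear) between two function spaces is biseparating if it is a bijection and for all $f,g,h$ in its domain: $f\perp_h g\iff Tf\perp_{Th}Tg$. The paper proves that every biseparating $T$ as in the claim admits a representation of the stated form. *)

theory Defs
  imports "HOL-Analysis.Analysis"
begin

definition C_space :: "('x::topological_space \<Rightarrow> 'e::real_normed_vector) set"
  where "C_space = {f. continuous_on UNIV f}"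

definition Cb_space :: "('x::topological_space \<Rightarrow> 'e::real_normed_vector) set"
  where "Cb_space = {f \<in> C_space. bounded (range f)}"

definition cozero :: "('x \<Rightarrow> 'e::zero) \<Rightarrow> 'x set"
  where "cozero f = {x. f x \<noteq> 0}"

definition perp :: "('x \<Rightarrow> 'e::group_add) \<Rightarrow> ('x \<Rightarrow> 'e) \<Rightarrow> ('x \<Rightarrow> 'e) \<Rightarrow> bool"
  where "perp h f g \<longleftrightarrow> cozero (\<lambda>x. f x - h x) \<inter> cozero (\<lambda>x. g x - h x) = {}"

text \<open>The map is a total HOL function, but only its restriction to \<open>A\<close> is constrained.\<close>

definition biseparating ::
    "('x \<Rightarrow> 'e::group_add) set \<Rightarrow> ('y \<Rightarrow> 'f::group_add) set \<Rightarrow>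
     (('x \<Rightarrow> 'e) \<Rightarrow> ('y \<Rightarrow> 'f)) \<Rightarrow> bool"
  where "biseparating A B T \<longleftrightarrow>
    bij_betw T A B \<and>
    (\<forall>f\<in>A. \<forall>g\<in>A. \<forall>h\<in>A. perp h f g \<longleftrightarrow> perp (T h) (T f) (T g))"

text \<open>The supremum is over nonnegative reals, so over the empty set it is \<open>0\<close>;
  \<open>Sup {}\<close> is unspecified on type \<open>real\<close>.\<close>

definition norm_on :: "'x set \<Rightarrow> ('x \<Rightarrow> 'e::real_normed_vector) \<Rightarrow> real"
  where "norm_on K f = (if K = {} then 0 else (SUP x\<in>K. norm (f x)))"

end

theory Submission
  imports Defs
begin

text \<open>
  The representation makes \<open>T\<close> a pointwise operator: up to the homeomorphism \<open>\<phi>\<close>, the value of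
  \<open>T g\<close> at a point depends only on the value of \<open>g\<close> there. Together with the continuity of all
  functions \<open>T g\<close>, this forces equicontinuity near an accumulation point \<open>x\<close>. Otherwise there
  are points \<open>z\<^sub>n\<close> tending to \<open>x\<close> and functions \<open>g\<^sub>n\<close> with \<open>g\<^sub>n z\<^sub>n - f z\<^sub>n\<close> tending to \<open>0\<close> whose
  images stay away from the image of \<open>f\<close> at \<open>z\<^sub>n\<close>. The point is that all these bad values can be
  collected in one admissible function \<open>h\<close>, with \<open>h x = f x\<close> and \<open>h z\<^sub>n = g\<^sub>n z\<^sub>n\<close>: such an \<open>h\<close>
  is \<open>f\<close> plus a bounded continuous function interpolating a null sequence
  (\<open>null_sequence_interpolation\<close>). The images of \<open>h\<close> and \<open>f\<close> agree at \<open>x\<close> but stay apart along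
  \<open>z\<^sub>n\<close>, which contradicts their continuity.

  Accumulation points are needed because interpolation requires \<open>z\<^sub>n \<noteq> x\<close>; a
  violation at \<open>x\<close> itself persists, by continuity, at nearby points other than \<open>x\<close>
  (\<open>pointwise_operator_equicontinuous_at\<close>). A finite subcover of the compact set \<open>\<phi> -` K\<close> then
  turns the local bounds into a uniform one.
\<close>

section \<open>Interpolation of null sequences\<close>

text \<open>
  The interpolating function is a sum of bumps supported on the shells where the distance to \<open>x\<close>
  lies strictly between \<open>3/4\<close> and \<open>5/4\<close> of the distance of \<open>a n\<close>. Halving of the distances makes
  these shells disjoint, so the tails of the sum are bounded by the suprema of the tails of \<open>d\<close>;
  this replaces the Weierstrass M-test, which would ask for a summable \<open>d\<close> and a complete
  target space.
\<close>

lemma null_sequence_interpolation: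
  fixes a :: "nat \<Rightarrow> 'a::metric_space" and d :: "nat \<Rightarrow> 'e::real_normed_vector"
  assumes ne: "\<And>n. a n \<noteq> x"
    and half: "\<And>n. dist (a (Suc n)) x \<le> dist (a n) x / 2"
    and d: "d \<longlonglongrightarrow> 0"
  obtains u where "u \<in> Cb_space" "u x = 0" "\<And>n. u (a n) = d n"
proof -
  define b where "b n z = max 0 (1 - 4 * \<bar>dist z x - dist (a n) x\<bar> / dist (a n) x)" for n z
  have pos: "dist (a n) x > 0" for n
    using ne by simp
  have anti: "dist (a m) x \<le> dist (a n) x" if "n \<le> m" for m n
    by (rule lift_Suc_antimono_le[OF _ that]) (use half pos in \<open>smt (verit) field_sum_of_halves\<close>)
  have far: "dist (a m) x \<le> dist (a n) x / 2" if "n < m" for m n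
    using anti[of "Suc n" m] half[of n] that by simp
  have shell: "3/4 * dist (a n) x < dist z x \<and> dist z x < 5/4 * dist (a n) x"
    if "b n z \<noteq> 0" for n z
  proof -
    have "4 * \<bar>dist z x - dist (a n) x\<bar> / dist (a n) x < 1"
      using that unfolding b_def by (metis diff_gt_0_iff_gt max.absorb1 not_less)
    then have "4 * \<bar>dist z x - dist (a n) x\<bar> < dist (a n) x"
      using pos[of n] by (simp add: divide_less_eq)
    then have "4 * (dist z x - dist (a n) x) < dist (a n) x" "4 * (dist (a n) x - dist z x) < dist (a n) x"
      by (auto simp: abs_if split: if_splits)
    then show ?thesis by auto
  qed
  have disj: "m = n" if "b m z \<noteq> 0" "b n z \<noteq> 0" for m n z
    using shell[OF that(1)] shell[OF that(2)] far[of m n] far[of n m] pos[of m] pos[of n]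
    by (cases m n rule: linorder_cases) linarith+
  have b01: "0 \<le> b n z" "b n z \<le> 1" for n z
    using pos[of n] by (auto simp: b_def)
  have b_cont: "continuous_on UNIV (b n)" for n
    unfolding b_def using ne by (intro continuous_intros) auto
  \<comment> \<open>At each point at most one summand survives, so this set is empty or a singleton.\<close>
  define u where "u z = (\<Sum>n\<in>{n. b n z \<noteq> 0}. b n z *\<^sub>R d n)" for z
  have u_single: "u z = b n z *\<^sub>R d n" if "b n z \<noteq> 0" for n z
  proof -
    have "{n. b n z \<noteq> 0} = {n}" using disj that by auto
    then show ?thesis by (simp add: u_def)
  qed
  have u_none: "u z = 0" if "\<And>n. b n z = 0" for z
    using that by (simp add: u_def)
  have partial: "(\<Sum>n<N. b n z *\<^sub>R d n) = (if n < N then b n z *\<^sub>R d n else 0)"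
    if "b n z \<noteq> 0" for n N z
  proof -
    have "(\<Sum>k<N. b k z *\<^sub>R d k) = (\<Sum>k<N. if k = n then b n z *\<^sub>R d n else 0)"
      using disj that by (intro sum.cong) auto
    then show ?thesis by (simp add: sum.delta)
  qed
  have lim: "uniform_limit UNIV (\<lambda>N z. \<Sum>n<N. b n z *\<^sub>R d n) u sequentially"
  proof (rule uniform_limitI)
    fix e :: real assume "e > 0"
    then obtain M where M: "\<And>n. n \<ge> M \<Longrightarrow> norm (d n) < e"
      using d by (auto simp: LIMSEQ_def)
    have "dist (\<Sum>n<N. b n z *\<^sub>R d n) (u z) < e" if "N \<ge> M" for N z
    proof (cases "\<exists>n. b n z \<noteq> 0")
      case True
      then obtain n where n: "b n z \<noteq> 0" by blast
      show ?thesis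
      proof (cases "n < N")
        case True
        then show ?thesis using \<open>e > 0\<close> by (simp add: partial[OF n] u_single[OF n])
      next
        case False
        have "norm (b n z *\<^sub>R d n) \<le> norm (d n)"
          using b01[of n z] by (simp add: mult_left_le_one_le)
        also have "\<dots> < e" using False that by (intro M) simp
        finally show ?thesis using False by (simp add: partial[OF n] u_single[OF n])
      qed
    next
      case False
      then show ?thesis using \<open>e > 0\<close> by (simp add: u_none)
    qed
    then show "\<forall>\<^sub>F N in sequentially. \<forall>z\<in>UNIV. dist (\<Sum>n<N. b n z *\<^sub>R d n) (u z) < e"
      by (auto simp: eventually_sequentially)
  qed
  have "continuous_on UNIV (\<lambda>z. \<Sum>n<N. b n z *\<^sub>R d n)" for N
    by (intro continuous_on_sum continuous_on_scaleR b_cont continuous_on_const)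
  then have u_cont: "continuous_on UNIV u"
    using uniform_limit_theorem[OF _ lim] by simp
  obtain B where B: "\<And>n. norm (d n) \<le> B"
    using convergent_imp_bounded[OF d] by (auto simp: bounded_iff)
  have "norm (u z) \<le> B" for z
  proof (cases "\<exists>n. b n z \<noteq> 0")
    case True
    then obtain n where n: "b n z \<noteq> 0" by blast
    have "norm (b n z *\<^sub>R d n) \<le> norm (d n)"
      using b01[of n z] by (simp add: mult_left_le_one_le)
    then show ?thesis using B[of n] by (simp add: u_single[OF n])
  next
    case False
    then show ?thesis using order_trans[OF norm_ge_zero B[of 0]] by (simp add: u_none)
  qed
  then have "u \<in> Cb_space"
    using u_cont by (auto simp: Cb_space_def C_space_def bounded_iff)
  moreover have "u x = 0"
    by (rule u_none) (use pos in \<open>simp add: b_def\<close>)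
  moreover have "u (a n) = d n" for n
  proof -
    have "b n (a n) = 1" by (simp add: b_def)
    then show ?thesis using u_single[of n "a n"] by simp
  qed
  ultimately show ?thesis using that by blast
qed

section \<open>Equicontinuity of pointwise operators at an accumulation point\<close>

text \<open>
  If no radius works, there are violations at points other than \<open>x\<close> arbitrarily close to \<open>x\<close>; a
  violation at \<open>x\<close> itself can be moved to a nearby point because \<open>x\<close> is not isolated.
  Interpolation merges a sequence of them into a single member of \<open>A\<close> whose image would be
  discontinuous at \<open>x\<close>. The radius serves all \<open>g\<close> at once, and \<open>g - f\<close> only has to be small at
  the single point \<open>z\<close>; both are used when finitely many such radii are combined on a compact set.
\<close>

lemma pointwise_operator_equicontinuous_at:
  fixes S :: "('x::metric_space \<Rightarrow> 'e::real_normed_vector) \<Rightarrow> 'x \<Rightarrow> 'f::real_normed_vector"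
  assumes cont: "A \<subseteq> C_space"
    and add: "\<And>f u. f \<in> A \<Longrightarrow> u \<in> Cb_space \<Longrightarrow> (\<lambda>z. f z + u z) \<in> A"
    and S_cont: "\<And>g. g \<in> A \<Longrightarrow> S g \<in> C_space"
    and pointwise: "\<And>g h z. g \<in> A \<Longrightarrow> h \<in> A \<Longrightarrow> g z = h z \<Longrightarrow> S g z = S h z"
    and x: "x islimpt UNIV" and f: "f \<in> A" and "\<epsilon> > 0"
  obtains \<eta> where "\<eta> > 0"
    "\<And>g z. g \<in> A \<Longrightarrow> dist z x < \<eta> \<Longrightarrow> norm (g z - f z) < \<eta> \<Longrightarrow> norm (S g z - S f z) \<le> \<epsilon>"
proof (rule ccontr)
  assume contra: "\<not> thesis"
  note radius = that
  have isCont_A: "isCont g z" if "g \<in> A" for g z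
    using cont that by (auto simp: C_space_def continuous_on_eq_continuous_at)
  have isCont_S: "isCont (S g) z" if "g \<in> A" for g z
    using S_cont[OF that] by (auto simp: C_space_def continuous_on_eq_continuous_at)
  have bad: "\<exists>z g. g \<in> A \<and> z \<noteq> x \<and> dist z x < \<eta> \<and> norm (g z - f z) < \<eta> \<and> norm (S g z - S f z) > \<epsilon>"
    if "\<eta> > 0" for \<eta>
  proof -
    have "\<not> (\<forall>g z. g \<in> A \<longrightarrow> dist z x < \<eta> \<longrightarrow> norm (g z - f z) < \<eta> \<longrightarrow> norm (S g z - S f z) \<le> \<epsilon>)"
    proof
      assume "\<forall>g z. g \<in> A \<longrightarrow> dist z x < \<eta> \<longrightarrow> norm (g z - f z) < \<eta> \<longrightarrow> norm (S g z - S f z) \<le> \<epsilon>"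
      then have thesis by (intro radius[OF \<open>\<eta> > 0\<close>]) simp
      with contra show False ..
    qed
    then obtain g p where g: "g \<in> A" and p: "dist p x < \<eta>" "norm (g p - f p) < \<eta>"
        "norm (S g p - S f p) > \<epsilon>"
      by (auto simp: not_le)
    show ?thesis
    proof (cases "p = x")
      case False
      then show ?thesis using g p by blast
    next
      case True
      \<comment> \<open>The three strict inequalities persist near \<open>x\<close>, hence at some point other than \<open>x\<close>.\<close>
      have "\<forall>\<^sub>F z in at x. dist z x < \<eta>"
        using \<open>\<eta> > 0\<close> by (auto simp: eventually_at)
      moreover have "\<forall>\<^sub>F z in at x. norm (g z - f z) < \<eta>"
        using p(2) True isCont_A g f
        by (intro order_tendstoD(2)[where y = "norm (g x - f x)"] tendsto_intros)
          (auto simp: isCont_def)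
      moreover have "\<forall>\<^sub>F z in at x. \<epsilon> < norm (S g z - S f z)"
        using p(3) True isCont_S g f
        by (intro order_tendstoD(1)[where y = "norm (S g x - S f x)"] tendsto_intros)
          (auto simp: isCont_def)
      moreover have "\<forall>\<^sub>F z in at x. z \<noteq> x"
        by (simp add: eventually_at_filter)
      ultimately have "\<forall>\<^sub>F z in at x. z \<noteq> x \<and> dist z x < \<eta> \<and> norm (g z - f z) < \<eta>
          \<and> norm (S g z - S f z) > \<epsilon>"
        by eventually_elim simp
      moreover have "at x \<noteq> bot"
        using x by (simp add: trivial_limit_within)
      ultimately show ?thesis
        using g eventually_happens' by blast
    qed
  qed
  \<comment> \<open>Violations whose error tends to zero, at points whose distance to \<open>x\<close> is at least halved in
    each step, as the interpolation requires.\<close>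
  define P where "P n q \<longleftrightarrow> snd q \<in> A \<and> fst q \<noteq> x \<and> norm (snd q (fst q) - f (fst q)) < inverse (Suc n)
      \<and> norm (S (snd q) (fst q) - S f (fst q)) > \<epsilon>" for n and q :: "'x \<times> ('x \<Rightarrow> 'e)"
  have "\<exists>q. \<forall>n. P n (q n) \<and> dist (fst (q (Suc n))) x \<le> dist (fst (q n)) x / 2"
  proof (rule dependent_nat_choice)
    show "\<exists>q. P 0 q"
      using bad[of 1] by (auto simp: P_def)
  next
    fix q n assume "P n q"
    then have "min (dist (fst q) x / 2) (inverse (Suc (Suc n))) > 0"
      by (simp add: P_def)
    from bad[OF this] show "\<exists>q'. P (Suc n) q' \<and> dist (fst q') x \<le> dist (fst q) x / 2"
      by (fastforce simp: P_def)
  qed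
  then obtain q where q: "\<And>n. P n (q n)"
    and half: "\<And>n. dist (fst (q (Suc n))) x \<le> dist (fst (q n)) x / 2"
    by blast
  define a g where "a n = fst (q n)" and "g n = snd (q n)" for n
  have a: "a n \<noteq> x" "dist (a (Suc n)) x \<le> dist (a n) x / 2"
    and g: "g n \<in> A" "norm (g n (a n) - f (a n)) < inverse (Suc n)"
      "norm (S (g n) (a n) - S f (a n)) > \<epsilon>" for n
    using q[of n] half[of n] by (auto simp: P_def a_def g_def)
  have "(\<lambda>n. g n (a n) - f (a n)) \<longlonglongrightarrow> 0"
    by (rule Lim_null_comparison[OF _ LIMSEQ_inverse_real_of_nat])
      (use g(2) in \<open>simp add: less_imp_le\<close>)
  then obtain u where u: "u \<in> Cb_space" "u x = 0" "\<And>n. u (a n) = g n (a n) - f (a n)"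
    by (rule null_sequence_interpolation[where a = a and x = x, OF a]) blast
  define h where "h z = f z + u z" for z
  have h: "h \<in> A"
    using add[OF f u(1)] by (simp add: h_def[abs_def])
  have "S h x = S f x"
    by (intro pointwise h f) (simp add: h_def u)
  moreover have Sh: "S h (a n) = S (g n) (a n)" for n
    by (intro pointwise h g) (simp add: h_def u)
  have geom: "dist (a n) x \<le> dist (a 0) x * (1/2) ^ n" for n
  proof (induction n)
    case (Suc n)
    then show ?case using a(2)[of n] by simp
  qed simp
  have "(\<lambda>n. dist (a 0) x * (1/2) ^ n) \<longlonglongrightarrow> 0"
    by (intro tendsto_mult_right_zero LIMSEQ_realpow_zero) auto
  then have "(\<lambda>n. dist (a n) x) \<longlonglongrightarrow> 0"
    by (rule Lim_null_comparison[rotated]) (simp add: geom)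
  then have "a \<longlonglongrightarrow> x"
    by (rule iffD2[OF tendsto_dist_iff])
  then have "(\<lambda>n. S h (a n)) \<longlonglongrightarrow> S h x" "(\<lambda>n. S f (a n)) \<longlonglongrightarrow> S f x"
    using isCont_tendsto_compose[OF isCont_S] h f by blast+
  then have "(\<lambda>n. norm (S h (a n) - S f (a n))) \<longlonglongrightarrow> norm (S h x - S f x)"
    by (intro tendsto_norm tendsto_diff)
  then have "\<epsilon> \<le> norm (S h x - S f x)"
    by (rule Lim_bounded2[where N = 0]) (use g(3) Sh in \<open>simp add: less_imp_le\<close>)
  ultimately show False
    using \<open>\<epsilon> > 0\<close> by simp
qed

section \<open>Continuity of biseparating maps on compact sets of accumulation points\<close>

theorem theorem6p6:
  fixes T :: "('x::metric_space \<Rightarrow> 'e::real_normed_vector) \<Rightarrow>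
              ('y::metric_space \<Rightarrow> 'f::real_normed_vector)"
    and AX :: "('x \<Rightarrow> 'e) set" and AY :: "('y \<Rightarrow> 'f) set"
    and \<phi> :: "'x \<Rightarrow> 'y"
    and \<Phi> :: "'y \<times> 'e \<Rightarrow> 'f" and \<Psi> :: "'x \<times> 'f \<Rightarrow> 'e"
    and K :: "'y set" and f :: "'x \<Rightarrow> 'e" and \<epsilon> :: real
  assumes "\<exists>u::'e. u \<noteq> 0" and "\<exists>v::'f. v \<noteq> 0"
    and "AX = C_space \<or> AX = Cb_space"
    and "AY = C_space \<or> AY = Cb_space"
    and "biseparating AX AY T"
    and "homeomorphism UNIV UNIV \<phi> (inv \<phi>)"
    and "\<And>f y. f \<in> AX \<Longrightarrow> T f y = \<Phi> (y, f (inv \<phi> y))"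
    and "\<And>g x. g \<in> AY \<Longrightarrow> inv_into AX T g x = \<Psi> (x, g (\<phi> x))"
    and "compact K" and "K \<subseteq> {y. y islimpt UNIV}"
    and "f \<in> AX" and "\<epsilon> > 0"
  shows "\<exists>\<delta>>0. \<forall>g\<in>AX.
           norm_on (\<phi> -` K) (\<lambda>x. g x - f x) < \<delta> \<longrightarrow>
           norm_on K (\<lambda>y. T g y - T f y) < \<epsilon>"
proof -
  have AX: "AX \<subseteq> C_space" and AY: "AY \<subseteq> C_space"
    using assms(3,4) by (auto simp: Cb_space_def)
  have add: "(\<lambda>z. g z + u z) \<in> AX" if "g \<in> AX" "u \<in> Cb_space" for g u
    using assms(3) that
    by (auto simp: Cb_space_def C_space_def intro!: continuous_intros bounded_plus_comp)
  have T_cont: "continuous_on UNIV (T g)" if "g \<in> AX" for g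
    using assms(5) that AY by (auto simp: biseparating_def bij_betw_def C_space_def)
  have \<phi>: "continuous_on UNIV \<phi>" "continuous_on UNIV (inv \<phi>)" "\<And>x. inv \<phi> (\<phi> x) = x"
    "\<And>y. \<phi> (inv \<phi> y) = y"
    using assms(6) by (auto simp: homeomorphism_def)
  define S where "S g = T g \<circ> \<phi>" for g
  have S_cont: "S g \<in> C_space" if "g \<in> AX" for g
    unfolding S_def C_space_def mem_Collect_eq
    by (intro continuous_on_compose \<phi> continuous_on_subset[OF T_cont[OF that]]) auto
  have pointwise: "S g z = S h z" if "g \<in> AX" "h \<in> AX" "g z = h z" for g h z
    using that by (simp add: S_def assms(7) \<phi>(3))
  have vim: "\<phi> -` K = inv \<phi> ` K"
    by (auto simp: \<phi>(4)) (metis \<phi>(3) image_eqI)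
  have cpt: "compact (\<phi> -` K)"
    unfolding vim using assms(9) \<phi>(2) by (intro compact_continuous_image continuous_on_subset[OF \<phi>(2)]) auto
  have limpt: "x islimpt UNIV" if "x \<in> \<phi> -` K" for x
  proof -
    have "\<not> open {x}"
    proof
      assume "open {x}"
      then have "open (inv \<phi> -` {x})"
        by (intro open_vimage \<phi>(2))
      moreover have "inv \<phi> -` {x} = {\<phi> x}"
        using \<phi>(3,4) by auto
      ultimately show False
        using assms(10) that by (auto simp: islimpt_UNIV_iff)
    qed
    then show ?thesis by (simp add: islimpt_UNIV_iff)
  qed
  have "\<exists>\<eta>>0. \<forall>g\<in>AX. \<forall>z. dist z x < \<eta> \<longrightarrow> norm (g z - f z) < \<eta> \<longrightarrow> norm (S g z - S f z) \<le> \<epsilon>/2"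
    if "x \<in> \<phi> -` K" for x
  proof (rule pointwise_operator_equicontinuous_at[where S = S and A = AX and x = x and f = f
        and \<epsilon> = "\<epsilon>/2"])
    show "x islimpt UNIV" by (rule limpt[OF that])
    show "\<epsilon>/2 > 0" using \<open>\<epsilon> > 0\<close> by simp
    fix \<eta> :: real
    assume "\<eta> > 0" and
      "\<And>g z. g \<in> AX \<Longrightarrow> dist z x < \<eta> \<Longrightarrow> norm (g z - f z) < \<eta> \<Longrightarrow> norm (S g z - S f z) \<le> \<epsilon>/2"
    then show ?thesis by blast
  qed (fact AX add S_cont pointwise \<open>f \<in> AX\<close>)+
  then obtain \<eta> where \<eta>: "\<And>x. x \<in> \<phi> -` K \<Longrightarrow> \<eta> x > 0"
    and bound: "\<And>x g z. x \<in> \<phi> -` K \<Longrightarrow> g \<in> AX \<Longrightarrow> dist z x < \<eta> x \<Longrightarrow> norm (g z - f z) < \<eta> x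
        \<Longrightarrow> norm (S g z - S f z) \<le> \<epsilon>/2"
    by metis
  obtain D where D: "D \<subseteq> \<phi> -` K" "finite D" "\<phi> -` K \<subseteq> (\<Union>x\<in>D. ball x (\<eta> x))"
    using compactE_image[OF cpt, of "\<phi> -` K" "\<lambda>x. ball x (\<eta> x)"] \<eta> by force
  \<comment> \<open>The extra element \<open>1\<close> keeps the minimum meaningful when \<open>K\<close> is empty.\<close>
  define \<delta> where "\<delta> = Min (insert 1 (\<eta> ` D))"
  have "\<delta> > 0"
    using D \<eta> by (auto simp: \<delta>_def)
  moreover have "norm_on K (\<lambda>y. T g y - T f y) < \<epsilon>"
    if g: "g \<in> AX" and close: "norm_on (\<phi> -` K) (\<lambda>x. g x - f x) < \<delta>" for g
  proof (cases "K = {}")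
    case True
    then show ?thesis using \<open>\<epsilon> > 0\<close> by (simp add: norm_on_def)
  next
    case False
    have "continuous_on UNIV (\<lambda>z. norm (g z - f z))"
      using AX g \<open>f \<in> AX\<close> by (auto simp: C_space_def intro!: continuous_intros)
    then have "compact ((\<lambda>z. norm (g z - f z)) ` (\<phi> -` K))"
      using cpt by (intro compact_continuous_image) (auto intro: continuous_on_subset)
    then have bdd: "bdd_above ((\<lambda>z. norm (g z - f z)) ` (\<phi> -` K))"
      by (intro bounded_imp_bdd_above compact_imp_bounded)
    have "norm (T g y - T f y) \<le> \<epsilon>/2" if "y \<in> K" for y
    proof -
      have z: "inv \<phi> y \<in> \<phi> -` K" using that \<phi>(4) by simp
      then obtain x where x: "x \<in> D" "dist (inv \<phi> y) x < \<eta> x"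
        using D(3) by (auto simp: dist_commute)
      have "norm (g (inv \<phi> y) - f (inv \<phi> y)) \<le> norm_on (\<phi> -` K) (\<lambda>x. g x - f x)"
        using z bdd by (auto simp: norm_on_def intro!: cSUP_upper)
      also have "\<dots> < \<delta>" by (rule close)
      also have "\<delta> \<le> \<eta> x" using x D(2) by (auto simp: \<delta>_def)
      finally have "norm (S g (inv \<phi> y) - S f (inv \<phi> y)) \<le> \<epsilon>/2"
        using bound x D(1) g by blast
      then show ?thesis by (simp add: S_def \<phi>(4))
    qed
    then have "norm_on K (\<lambda>y. T g y - T f y) \<le> \<epsilon>/2"
      using False by (simp add: norm_on_def cSUP_least del: divide_le_eq_numeral1 le_divide_eq_numeral1)
    then show ?thesis using \<open>\<epsilon> > 0\<close> by simp
  qed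
  ultimately show ?thesis by blast
qed

end
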